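(* Let $M$ be a module over the Virasoro algebra $\mathfrak{V}$ which, by restriction, is a free $\mathbb{C}[d_0]$-module of rank $1$. Then $M\cong\Omega(\lambda,a)$ as $\mathfrak{V}$-modules for some $a\in\mathbb{C}$ and $\lambda\in\mathbb{C}^*$.
   Context: $\mathbb{C}^*=\mathbb{C}\setminus\{0\}$. The Virasoro algebra is the complex Lie algebra $\mathfrak{V}=\big(\bigoplus_{i\in\mathbb{Z}}\mathbb{C}d_i\big)\oplus\mathbb{C}C$ with bracket $$[C,d_i]=0,\qquad [d_i,d_j]=(j-i)d_{i+j}+\delta_{i,-j}\frac{i^3-i}{12}C,\qquad i,j\in\mathbb{Z}.$$ Here $\mathbb{C}[d_0]=U(\mathbb{C}d_0)$ is the universal enveloping algebra of the one-dimensional subalgebra $\mathbb{C}d_0$. For $\lambda\in\mathbb{C}^*$, $a\in\mathbb{C}$, the $\mathfrak{V}$-module $\Omega(\lambda,a)$ is the vector space $\mathbb{C}[x]$ with action $$Cf(x)=0,\qquad d_i f(x)=\lambda^i\,(x-i(a+1))\,f(x-i),\qquad i\in\mathbb{Z},\ f(x)\in\mathbb{C}[x].$$ *)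

theory Defs
  imports Complex_Main "HOL-Library.Poly_Mapping" "HOL-Computational_Algebra.Polynomial"
begin

section \<open>Lie algebras and their modules\<close>

locale lie_algebra = vector_space scale
  for scale :: "'k::field \<Rightarrow> 'g::ab_group_add \<Rightarrow> 'g" +
  fixes bracket :: "'g \<Rightarrow> 'g \<Rightarrow> 'g"
  assumes bracket_add_left: "bracket (x + y) z = bracket x z + bracket y z"
    and bracket_add_right: "bracket x (y + z) = bracket x y + bracket x z"
    and bracket_scale_left: "bracket (scale c x) y = scale c (bracket x y)"
    and bracket_scale_right: "bracket x (scale c y) = scale c (bracket x y)"
    and bracket_self: "bracket x x = 0"
    and jacobi: "bracket x (bracket y z) + bracket y (bracket z x) + bracket z (bracket x y) = 0"

locale lie_module = L: lie_algebra scaleL bracket + M: vector_space scaleM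
  for scaleL :: "'k::field \<Rightarrow> 'g::ab_group_add \<Rightarrow> 'g"
    and bracket :: "'g \<Rightarrow> 'g \<Rightarrow> 'g"
    and scaleM :: "'k \<Rightarrow> 'm::ab_group_add \<Rightarrow> 'm" +
  fixes act :: "'g \<Rightarrow> 'm \<Rightarrow> 'm"
  assumes act_add_left: "act (x + y) m = act x m + act y m"
    and act_add_right: "act x (m + n) = act x m + act x n"
    and act_scale_left: "act (scaleL c x) m = scaleM c (act x m)"
    and act_scale_right: "act x (scaleM c m) = scaleM c (act x m)"
    and act_bracket: "act (bracket x y) m = act x (act y m) - act y (act x m)"

definition lie_module_isomorphic ::
  "('k::field \<Rightarrow> 'm::ab_group_add \<Rightarrow> 'm) \<Rightarrow> ('g \<Rightarrow> 'm \<Rightarrow> 'm) \<Rightarrow>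
   ('k \<Rightarrow> 'n::ab_group_add \<Rightarrow> 'n) \<Rightarrow> ('g \<Rightarrow> 'n \<Rightarrow> 'n) \<Rightarrow> bool"
  where "lie_module_isomorphic scaleM actM scaleN actN \<longleftrightarrow>
    (\<exists>\<phi>. Vector_Spaces.linear scaleM scaleN \<phi> \<and> bij \<phi> \<and>
         (\<forall>x m. \<phi> (actM x m) = actN x (\<phi> m)))"

definition (in module) free_of_rank :: "nat \<Rightarrow> bool"
  where "free_of_rank n \<longleftrightarrow>
    (\<exists>B. independent B \<and> span B = UNIV \<and> finite B \<and> card B = n)"

text \<open>
  For an endomorphism \<open>T\<close> of a vector space, \<open>poly_act scale T\<close> is the resulting scalar
  multiplication by polynomials, the indeterminate acting as \<open>T\<close>. The enveloping algebra of the
  one-dimensional Lie algebra spanned by an element \<open>d\<close> is the polynomial algebra in \<open>d\<close>, so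
  with \<open>T = act d\<close> this is the restriction of a Lie module to that algebra.
\<close>

definition poly_act ::
  "('k::field \<Rightarrow> 'm::ab_group_add \<Rightarrow> 'm) \<Rightarrow> ('m \<Rightarrow> 'm) \<Rightarrow> 'k poly \<Rightarrow> 'm \<Rightarrow> 'm"
  where "poly_act scale T p m = (\<Sum>k\<le>degree p. scale (coeff p k) ((T ^^ k) m))"

lemma poly_act_bound:
  assumes "vector_space scale" "degree p \<le> n"
  shows "poly_act scale T p m = (\<Sum>k\<le>n. scale (coeff p k) ((T ^^ k) m))"
proof -
  interpret vector_space scale by fact
  show ?thesis unfolding poly_act_def
    using assms(2) by (intro sum.mono_neutral_left) (auto simp: coeff_eq_0)
qed

lemma poly_act_pCons:
  assumes "Vector_Spaces.linear scale scale T"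
  shows "poly_act scale T (pCons c p) m = scale c m + T (poly_act scale T p m)"
proof -
  interpret Vector_Spaces.linear scale scale T by fact
  have "poly_act scale T (pCons c p) m
      = (\<Sum>k\<le>Suc (degree p). scale (coeff (pCons c p) k) ((T ^^ k) m))"
    by (rule poly_act_bound[OF vs1.vector_space_axioms degree_pCons_le])
  also have "\<dots> = scale c m + (\<Sum>k\<le>degree p. scale (coeff p k) (T ((T ^^ k) m)))"
    by (subst sum.atMost_Suc_shift) simp
  also have "\<dots> = scale c m + T (poly_act scale T p m)"
    by (simp add: poly_act_def sum scale)
  finally show ?thesis .
qed

lemma module_poly_act:
  assumes "Vector_Spaces.linear scale scale T"
  shows "module (poly_act scale T)"
proof -
  interpret Vector_Spaces.linear scale scale T by fact
  note vs = vs1.vector_space_axioms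
  have pow_add: "(T ^^ k) (x + y) = (T ^^ k) x + (T ^^ k) y" for k x y
    by (induction k) (simp_all add: add)
  have zero_l: "poly_act scale T 0 x = 0" for x
    by (simp add: poly_act_def)
  have add_r: "poly_act scale T p (x + y) = poly_act scale T p x + poly_act scale T p y" for p x y
    by (simp add: poly_act_def pow_add vs1.scale_right_distrib sum.distrib)
  have add_l: "poly_act scale T (p + q) x = poly_act scale T p x + poly_act scale T q x" for p q x
  proof -
    let ?n = "max (degree p) (degree q)"
    have "degree (p + q) \<le> ?n" by (rule degree_add_le_max)
    then show ?thesis
      by (simp add: poly_act_bound[OF vs, where n = ?n] vs1.scale_left_distrib sum.distrib)
  qed
  have smult: "poly_act scale T (smult c q) x = scale c (poly_act scale T q x)" for c q x
    by (simp add: poly_act_bound[OF vs degree_smult_le] poly_act_def vs1.scale_sum_right)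
  have mult: "poly_act scale T (p * q) x = poly_act scale T p (poly_act scale T q x)" for p q x
    by (induction p) (simp_all add: zero_l add_l smult poly_act_pCons[OF assms])
  have one: "poly_act scale T 1 x = x" for x
    by (simp add: poly_act_def)
  show ?thesis
    by unfold_locales (simp_all add: add_l add_r mult one)
qed

lemma (in lie_module) module_restrict: "module (poly_act scaleM (act d))"
  by (rule module_poly_act, simp add: Vector_Spaces.linear_iff M.vector_space_axioms
        act_add_right act_scale_right)


section \<open>The Virasoro algebra\<close>

text \<open>The basis: \<open>VirD i\<close> stands for \<open>d\<^sub>i\<close> and \<open>VirC\<close> for the central element \<open>C\<close>.\<close>

datatype vir_basis = VirD int | VirC

type_synonym virasoro = "vir_basis \<Rightarrow>\<^sub>0 complex"

definition vir_scale :: "complex \<Rightarrow> virasoro \<Rightarrow> virasoro"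
  where "vir_scale c = Poly_Mapping.map (\<lambda>z. c * z)"

abbreviation vir_d :: "int \<Rightarrow> virasoro"
  where "vir_d i \<equiv> Poly_Mapping.single (VirD i) 1"

abbreviation vir_c :: virasoro
  where "vir_c \<equiv> Poly_Mapping.single VirC 1"

definition linear_ext ::
  "('k::zero \<Rightarrow> 'v::comm_monoid_add \<Rightarrow> 'v) \<Rightarrow> ('b \<Rightarrow> 'v) \<Rightarrow> ('b \<Rightarrow>\<^sub>0 'k) \<Rightarrow> 'v"
  where "linear_ext scale f x =
    (\<Sum>u\<in>Poly_Mapping.keys x. scale (Poly_Mapping.lookup x u) (f u))"

fun vir_basis_bracket :: "vir_basis \<Rightarrow> vir_basis \<Rightarrow> virasoro"
  where
    "vir_basis_bracket (VirD i) (VirD j) =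
       vir_scale (of_int (j - i)) (vir_d (i + j)) +
       (if i = - j then vir_scale ((of_int i ^ 3 - of_int i) / 12) vir_c else 0)"
  | "vir_basis_bracket (VirD i) VirC = 0"
  | "vir_basis_bracket VirC v = 0"

definition vir_bracket :: "virasoro \<Rightarrow> virasoro \<Rightarrow> virasoro"
  where "vir_bracket x y =
    linear_ext vir_scale (\<lambda>u. linear_ext vir_scale (vir_basis_bracket u) y) x"

lemma lookup_vir_scale [simp]:
  "Poly_Mapping.lookup (vir_scale c x) u = c * Poly_Mapping.lookup x u"
  unfolding vir_scale_def by transfer (simp add: when_def)

lemma vir_scale_single [simp]:
  "vir_scale c (Poly_Mapping.single u z) = Poly_Mapping.single u (c * z)"
  unfolding vir_scale_def by simp

lemma vector_space_vir: "vector_space vir_scale"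
  by unfold_locales (auto intro!: poly_mapping_eqI simp: lookup_add algebra_simps)

interpretation vir: vector_space vir_scale
  by (rule vector_space_vir)

lemma linear_ext_superset:
  assumes "vector_space scale" "finite A" "Poly_Mapping.keys x \<subseteq> A"
  shows "linear_ext scale f x = (\<Sum>u\<in>A. scale (Poly_Mapping.lookup x u) (f u))"
proof -
  interpret vector_space scale by fact
  show ?thesis unfolding linear_ext_def
    using assms(2,3) by (intro sum.mono_neutral_left) (auto simp: in_keys_iff)
qed

lemma linear_ext_zero [simp]: "linear_ext scale f 0 = 0"
  by (simp add: linear_ext_def)

lemma linear_ext_add:
  assumes "vector_space scale"
  shows "linear_ext scale f (x + y) = linear_ext scale f x + linear_ext scale f y"
proof -
  interpret vector_space scale by fact
  let ?A = "Poly_Mapping.keys x \<union> Poly_Mapping.keys y"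
  have "Poly_Mapping.keys (x + y) \<subseteq> ?A" by (rule Poly_Mapping.keys_add)
  then show ?thesis
    by (simp add: linear_ext_superset[OF assms, where A = ?A] lookup_add scale_left_distrib
        sum.distrib)
qed

lemma linear_ext_scale:
  assumes "vector_space scale"
  shows "linear_ext scale f (vir_scale c x) = scale c (linear_ext scale f x)"
proof -
  interpret vector_space scale by fact
  have "Poly_Mapping.keys (vir_scale c x) \<subseteq> Poly_Mapping.keys x"
    by (auto simp: in_keys_iff)
  then show ?thesis
    by (simp add: linear_ext_superset[OF assms, where A = "Poly_Mapping.keys x"] scale_sum_right)
qed

lemma linear_ext_single [simp]:
  assumes "vector_space scale"
  shows "linear_ext scale f (Poly_Mapping.single u c) = scale c (f u)"
proof -
  interpret vector_space scale by fact
  show ?thesis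
    by (simp add: linear_ext_superset[OF assms, where A = "{u}"])
qed

lemma virasoro_induct [case_names single add]:
  fixes x :: virasoro
  assumes single: "\<And>u c. P (Poly_Mapping.single u c)"
    and add: "\<And>x y. P x \<Longrightarrow> P y \<Longrightarrow> P (x + y)"
  shows "P x"
proof -
  have zero: "P 0"
    using single[of VirC 0] by simp
  have sums: "P (\<Sum>u\<in>A. Poly_Mapping.single u (Poly_Mapping.lookup x u))" if "finite A" for A
    using that by (induction A rule: finite_induct) (auto intro: zero single add)
  have "x = (\<Sum>u\<in>Poly_Mapping.keys x. Poly_Mapping.single u (Poly_Mapping.lookup x u))"
    by (rule poly_mapping_eqI)
      (simp add: lookup_sum lookup_single when_def in_keys_iff)
  with sums[OF finite_keys] show ?thesis by metis
qed

lemma vir_bracket_add_left: "vir_bracket (x + y) z = vir_bracket x z + vir_bracket y z"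
  by (simp add: vir_bracket_def linear_ext_add[OF vector_space_vir])

lemma vir_bracket_scale_left: "vir_bracket (vir_scale c x) y = vir_scale c (vir_bracket x y)"
  by (simp add: vir_bracket_def linear_ext_scale[OF vector_space_vir])

lemma vir_bracket_add_right: "vir_bracket x (y + z) = vir_bracket x y + vir_bracket x z"
  by (simp add: vir_bracket_def linear_ext_add[OF vector_space_vir])
    (simp add: linear_ext_def vir.scale_right_distrib sum.distrib)

lemma vir_bracket_scale_right: "vir_bracket x (vir_scale c y) = vir_scale c (vir_bracket x y)"
  by (simp add: vir_bracket_def linear_ext_scale[OF vector_space_vir])
    (simp add: linear_ext_def vir.scale_sum_right mult.commute mult.left_commute)

lemma vir_bracket_single:
  "vir_bracket (Poly_Mapping.single u a) (Poly_Mapping.single v b) =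
   vir_scale (a * b) (vir_basis_bracket u v)"
  by (simp add: vir_bracket_def vector_space_vir)

lemma vir_bracket_zero [simp]: "vir_bracket 0 x = 0" "vir_bracket x 0 = 0"
  using vir_bracket_add_left[of 0 0 x] vir_bracket_add_right[of x 0 0] by simp_all

lemma vir_bracket_basis:
  "vir_bracket (vir_d i) (vir_d j) =
     vir_scale (of_int (j - i)) (vir_d (i + j)) +
     (if i = - j then vir_scale ((of_int i ^ 3 - of_int i) / 12) vir_c else 0)"
  "vir_bracket vir_c x = 0"
  "vir_bracket x vir_c = 0"
proof -
  show "vir_bracket vir_c x = 0" "vir_bracket x vir_c = 0"
    by (induction x rule: virasoro_induct;
        simp add: vir_bracket_single vir_bracket_add_left vir_bracket_add_right;
        metis vir_basis.exhaust vir_basis_bracket.simps vir.scale_zero_right)+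
qed (simp add: vir_bracket_single)

lemma vir_bracket_swap: "vir_bracket x y = - vir_bracket y x"
proof (induction x rule: virasoro_induct)
  case (single u c)
  show ?case
  proof (induction y rule: virasoro_induct)
    case (single v b)
    show ?case
      by (cases u; cases v)
        (auto simp: vir_bracket_single lookup_add lookup_single when_def algebra_simps
          power3_eq_cube diff_divide_distrib intro!: poly_mapping_eqI)
  qed (simp add: vir_bracket_add_left vir_bracket_add_right)
qed (simp add: vir_bracket_add_left vir_bracket_add_right)

lemma vir_jacobi_basis:
  fixes u v w :: vir_basis
  defines "e \<equiv> \<lambda>t. Poly_Mapping.single t (1 :: complex)"
  shows "vir_bracket (e u) (vir_bracket (e v) (e w)) + vir_bracket (e v) (vir_bracket (e w) (e u)) +
    vir_bracket (e w) (vir_bracket (e u) (e v)) = 0"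
proof (cases "u = VirC \<or> v = VirC \<or> w = VirC")
  case True
  then show ?thesis
    by (auto simp: e_def vir_bracket_basis)
next
  case False
  then obtain i j k where uvw: "u = VirD i" "v = VirD j" "w = VirD k"
    by (metis vir_basis.exhaust)
  have nested: "vir_bracket (vir_d i) (vir_bracket (vir_d j) (vir_d k)) =
      Poly_Mapping.single (VirD (i + j + k)) (of_int ((k - j) * (j + k - i))) +
      Poly_Mapping.single VirC
        (if i + j + k = 0 then of_int (k - j) * (of_int i ^ 3 - of_int i) / 12 else 0)" for i j k
  proof -
    have "vir_bracket (vir_d i) (vir_bracket (vir_d j) (vir_d k)) =
        vir_scale (of_int (k - j)) (vir_bracket (vir_d i) (vir_d (j + k)))"
      by (simp only: vir_bracket_basis(1)[of j k] vir_bracket_add_right vir_bracket_scale_right)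
        (simp add: vir_bracket_basis(3) vir_bracket_scale_right del: vir_scale_single)
    then show ?thesis
      by (auto simp: vir_bracket_basis(1) lookup_add lookup_single when_def add.assoc
          eq_neg_iff_add_eq_0 intro!: poly_mapping_eqI)
  qed
  have rot: "j + k + i = i + j + k" "k + i + j = i + j + k" by simp_all
  have k: "k = - i - j" if "i + j + k = 0" using that by simp
  show ?thesis
    unfolding uvw e_def nested rot
    by (cases "i + j + k = 0"; intro poly_mapping_eqI, rename_tac t, case_tac t)
      (auto simp: lookup_add lookup_single when_def k field_simps power3_eq_cube)
qed

lemma vir_jacobi:
  "vir_bracket x (vir_bracket y z) + vir_bracket y (vir_bracket z x) +
   vir_bracket z (vir_bracket x y) = 0"
proof (induction x rule: virasoro_induct)
  case x: (single u a)
  show ?case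
  proof (induction y rule: virasoro_induct)
    case y: (single v b)
    show ?case
    proof (induction z rule: virasoro_induct)
      case z: (single w c)
      have scale: "Poly_Mapping.single t r = vir_scale r (Poly_Mapping.single t 1)" for t r
        by simp
      show ?case
        using vir_jacobi_basis[of u v w]
        by (subst (1 2 3) scale[of u a], subst (1 2 3) scale[of v b], subst (1 2 3) scale[of w c])
          (simp del: vir_scale_single add: vir_bracket_scale_left vir_bracket_scale_right
            mult_ac flip: vir.scale_right_distrib)
    next
      case (add z z')
      then show ?case
        by (simp add: vir_bracket_add_left vir_bracket_add_right add_eq_0_iff)
    qed
  next
    case (add y y')
    then show ?case
      by (simp add: vir_bracket_add_left vir_bracket_add_right add_eq_0_iff)
  qed
next
  case (add x x')
  then show ?case
    by (simp add: vir_bracket_add_left vir_bracket_add_right add_eq_0_iff)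
qed

lemma lie_algebra_vir: "lie_algebra vir_scale vir_bracket"
proof unfold_locales
  show "vir_bracket x x = 0" for x
  proof (rule poly_mapping_eqI)
    fix u
    from vir_bracket_swap[of x x]
    have "Poly_Mapping.lookup (vir_bracket x x) u = - Poly_Mapping.lookup (vir_bracket x x) u"
      by (metis lookup_uminus)
    then show "Poly_Mapping.lookup (vir_bracket x x) u = Poly_Mapping.lookup 0 u"
      by (simp add: eq_neg_iff_add_eq_0)
  qed
qed (simp_all add: vir_bracket_add_left vir_bracket_add_right vir_bracket_scale_left
    vir_bracket_scale_right vir_jacobi)


section \<open>The modules \<open>\<Omega>(\<lambda>, a)\<close>\<close>

text \<open>Here \<open>pcompose f [:- i, 1:]\<close> is \<open>f(x - i)\<close>.\<close>

fun omega_basis_act :: "complex \<Rightarrow> complex \<Rightarrow> vir_basis \<Rightarrow> complex poly \<Rightarrow> complex poly"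
  where
    "omega_basis_act l a (VirD i) f =
       smult (l powi i) ([:- (of_int i * (a + 1)), 1:] * pcompose f [:- of_int i, 1:])"
  | "omega_basis_act l a VirC f = 0"

definition omega_act :: "complex \<Rightarrow> complex \<Rightarrow> virasoro \<Rightarrow> complex poly \<Rightarrow> complex poly"
  where "omega_act l a x f = linear_ext smult (\<lambda>u. omega_basis_act l a u f) x"

lemma vector_space_poly: "vector_space (smult :: complex \<Rightarrow> complex poly \<Rightarrow> complex poly)"
  by unfold_locales (simp_all add: smult_add_right smult_add_left)

lemma omega_act_single:
  "omega_act l a (Poly_Mapping.single u c) f = smult c (omega_basis_act l a u f)"
  by (simp add: omega_act_def vector_space_poly)

lemma omega_act_add_left: "omega_act l a (x + y) f = omega_act l a x f + omega_act l a y f"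
  by (simp add: omega_act_def linear_ext_add[OF vector_space_poly])

lemma omega_act_zero_left [simp]: "omega_act l a 0 f = 0"
  by (simp add: omega_act_def)

lemma omega_act_scale_left: "omega_act l a (vir_scale c x) f = smult c (omega_act l a x f)"
  by (simp add: omega_act_def linear_ext_scale[OF vector_space_poly])

lemma omega_act_add_right: "omega_act l a x (f + g) = omega_act l a x f + omega_act l a x g"
proof (induction x rule: virasoro_induct)
  case (single u c)
  show ?case
    by (cases u) (simp_all add: omega_act_single pcompose_add algebra_simps smult_add_right)
qed (simp add: omega_act_add_left)

lemma omega_act_scale_right: "omega_act l a x (smult c f) = smult c (omega_act l a x f)"
proof (induction x rule: virasoro_induct)
  case (single u b)
  show ?case
    by (cases u) (simp_all add: omega_act_single pcompose_smult algebra_simps smult_add_right)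
qed (simp add: omega_act_add_left smult_add_right)

lemma omega_act_zero_right [simp]: "omega_act l a x 0 = 0"
  using omega_act_add_right[of l a x 0 0] by simp

lemma omega_act_bracket:
  assumes "l \<noteq> 0"
  shows "omega_act l a (vir_bracket x y) f =
    omega_act l a x (omega_act l a y f) - omega_act l a y (omega_act l a x f)"
proof (induction x rule: virasoro_induct)
  case (single u b)
  show ?case
  proof (induction y rule: virasoro_induct)
    case (single v c)
    show ?case
    proof (cases "u = VirC \<or> v = VirC")
      case True
      then show ?thesis
        by (cases u; cases v) (auto simp: vir_bracket_single omega_act_single)
    next
      case False
      then obtain i j where uv: "u = VirD i" "v = VirD j"
        by (metis vir_basis.exhaust)
      have "omega_act l a (vir_basis_bracket u v) f =
          smult (of_int (j - i)) (omega_basis_act l a (VirD (i + j)) f)"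
        by (simp add: uv omega_act_add_left omega_act_single)
      moreover have "poly (smult (of_int (j - i)) (omega_basis_act l a (VirD (i + j)) f)) z =
          poly (omega_basis_act l a u (omega_basis_act l a v f) -
            omega_basis_act l a v (omega_basis_act l a u f)) z" for z
        using assms
        by (simp add: uv poly_pcompose power_int_add) (simp add: algebra_simps)
      ultimately have "omega_act l a (vir_basis_bracket u v) f =
          omega_basis_act l a u (omega_basis_act l a v f) -
          omega_basis_act l a v (omega_basis_act l a u f)"
        by (metis poly_ext)
      moreover have "omega_basis_act l a t (smult r g) = smult r (omega_basis_act l a t g)" for t r g
        using omega_act_scale_right[of l a "Poly_Mapping.single t 1" r g]
        by (simp add: omega_act_single)
      ultimately show ?thesis
        by (simp add: vir_bracket_single omega_act_scale_left omega_act_single smult_diff_right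
            mult.commute)
    qed
  qed (simp add: vir_bracket_add_right omega_act_add_left omega_act_add_right)
qed (simp add: vir_bracket_add_left omega_act_add_left omega_act_add_right)

lemma lie_module_omega:
  assumes "l \<noteq> 0"
  shows "lie_module vir_scale vir_bracket smult (omega_act l a)"
proof -
  interpret lie_algebra vir_scale vir_bracket by (rule lie_algebra_vir)
  interpret P: vector_space "smult :: complex \<Rightarrow> complex poly \<Rightarrow> complex poly"
    by (rule vector_space_poly)
  show ?thesis
    by unfold_locales (simp_all add: omega_act_add_left omega_act_add_right omega_act_scale_left
        omega_act_scale_right omega_act_bracket[OF assms])
qed

end

theory Submission
  imports Defs
begin

text \<open>
  A free generator \<open>v\<close> of \<open>M\<close> over \<open>\<complex>[d\<^sub>0]\<close> identifies \<open>M\<close> with \<open>\<complex>[x]\<close>, where \<open>d\<^sub>0\<close> becomes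
  multiplication by \<open>x\<close> (\<open>lie_module_transport\<close>). The relation \<open>[d\<^sub>0, d\<^sub>i] = i d\<^sub>i\<close> then says
  \<open>d\<^sub>i x = (x - i) d\<^sub>i\<close>, which forces \<open>d\<^sub>i f(x) = g\<^sub>i(x) f(x - i)\<close> with \<open>g\<^sub>i = d\<^sub>i 1\<close>, while \<open>C\<close> acts as
  multiplication by a polynomial \<open>c\<close> (\<open>shift_semilinear\<close>). Everything is thus encoded in \<open>c\<close> and in
  the family \<open>g\<^sub>i\<close>, subject to the functional equations collected in the locale
  \<open>virasoro_rank_one\<close>; solving them determines the module.

  The bracket \<open>[d\<^sub>i, d\<^bsub>-i\<^esub>]\<close> prescribes \<open>h(x + i) - h(x)\<close> for \<open>h(x) = g\<^sub>i(x) g\<^bsub>-i\<^esub>(x - i)\<close>. For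
  \<open>i = 1\<close> the central term is absent, so \<open>g\<^sub>1 \<noteq> 0\<close>; since \<open>C\<close> commutes with \<open>d\<^sub>1\<close>, the polynomial
  \<open>c\<close> has period 1 and is constant. Consequently \<open>h(x + i) - h(x)\<close> is \<open>2 i x\<close> up to a constant for
  every \<open>i \<noteq> 0\<close>, so \<open>deg g\<^sub>i + deg g\<^bsub>-i\<^esub> = 2\<close>. The decisive point is that no \<open>g\<^sub>i\<close> with
  \<open>i \<noteq> 0\<close> is constant (\<open>degree_nonzero\<close>): bracketing with a constant \<open>g\<^sub>i\<close> is a difference
  operator, and applying it three times to \<open>g\<^bsub>2i\<^esub>\<close>, of degree at most 2, would kill \<open>g\<^bsub>5i\<^esub>\<close>. Hence
  each \<open>g\<^sub>i\<close> is linear, say \<open>g\<^sub>i = l\<^sub>i (x - b\<^sub>i)\<close>. Comparing coefficients in the brackets leaves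
  recursions whose only solutions are \<open>l\<^sub>i = l\<^sub>1\<^sup>i\<close> and \<open>b\<^sub>i = i b\<^sub>1\<close>; the latter makes \<open>b\<^sub>i + b\<^bsub>-i\<^esub>\<close>
  vanish, and this sum is a nonzero multiple of \<open>c\<close> for \<open>i = 2\<close>, so \<open>c = 0\<close>. This is
  \<open>\<Omega>(\<lambda>, a)\<close> with \<open>\<lambda> = l\<^sub>1\<close> and \<open>a = b\<^sub>1 - 1\<close>.
\<close>

section \<open>Polynomials and translations of the variable\<close>

lemma periodic_poly_constant:
  fixes p :: "complex poly"
  assumes "k \<noteq> 0" and per: "\<And>z. poly p (z + k) = poly p z"
  shows "poly p z = poly p 0"
proof -
  have "poly p (of_nat n * k) = poly p 0" for n
  proof (induction n)
    case (Suc n)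
    then show ?case using per[of "of_nat n * k"] by (simp add: algebra_simps)
  qed simp
  then have "range (\<lambda>n. of_nat n * k) \<subseteq> {z. poly (p - [:poly p 0:]) z = 0}"
    by auto
  moreover have "infinite (range (\<lambda>n. of_nat n * k))"
    using \<open>k \<noteq> 0\<close> by (intro range_inj_infinite) (auto simp: inj_def)
  ultimately have "infinite {z. poly (p - [:poly p 0:]) z = 0}"
    by (metis finite_subset)
  then have "p - [:poly p 0:] = 0"
    using poly_roots_finite by blast
  then show ?thesis
    by (metis add.right_neutral eq_iff_diff_eq_0 mult_zero_right poly_0 poly_pCons)
qed

text \<open>
  Subtracting the quadratic \<open>x\<^sup>2 + s x\<close> with the same differences leaves a periodic polynomial.
\<close>
lemma degree_of_linear_difference:
  fixes p :: "complex poly"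
  assumes "k \<noteq> 0" and diff: "\<And>z. poly p (z + k) - poly p z = 2 * k * z + e"
  shows "degree p = 2"
proof -
  define s where "s = (e - k\<^sup>2) / k"
  define q where "q = p - [:0, s, 1:]"
  have "poly q (z + k) = poly q z" for z
    using diff[of z] \<open>k \<noteq> 0\<close>
    by (simp add: q_def s_def field_simps power2_eq_square)
  then have const: "poly q z = poly q 0" for z
    using periodic_poly_constant \<open>k \<noteq> 0\<close> by blast
  have "p = [:poly q 0, s, 1:]"
  proof (rule poly_ext)
    show "poly p z = poly [:poly q 0, s, 1:] z" for z
      using const[of z] by (simp add: q_def algebra_simps)
  qed
  then show ?thesis by simp
qed

lemma poly_of_degree_le_2:
  fixes p :: "complex poly"
  assumes "degree p \<le> 2"
  obtains u v w where "\<And>z. poly p z = u + v * z + w * z\<^sup>2"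
proof
  have p: "p = [:coeff p 0, coeff p 1, coeff p 2:]"
    using assms by (intro poly_eqI) (auto simp: coeff_pCons numeral_2_eq_2 coeff_eq_0 split: nat.split)
  show "poly p z = coeff p 0 + coeff p 1 * z + coeff p 2 * z\<^sup>2" for z
    by (subst p) (simp add: algebra_simps power2_eq_square)
qed

text \<open>
  Moving the variable past \<open>T\<close> costs a shift by \<open>k\<close>, so \<open>T\<close> is determined by its value at 1. The
  operators \<open>d\<^sub>i\<close> are of this kind with \<open>k = i\<close>, and \<open>C\<close> with \<open>k = 0\<close>.
\<close>
lemma shift_semilinear:
  fixes T :: "complex poly \<Rightarrow> complex poly"
  assumes add: "\<And>p q. T (p + q) = T p + T q"
    and scale: "\<And>r p. T (smult r p) = smult r (T p)"
    and shift: "\<And>p. T ([:0, 1:] * p) = [:- k, 1:] * T p"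
  shows "T p = T 1 * pcompose p [:- k, 1:]"
proof (induction p)
  case 0
  show ?case using scale[of 0 0] by simp
next
  case (pCons r p)
  have "pCons r p = smult r 1 + [:0, 1:] * p"
    by simp
  then have "T (pCons r p) = smult r (T 1) + [:- k, 1:] * T p"
    by (metis add scale shift)
  also have "\<dots> = T 1 * pcompose (pCons r p) [:- k, 1:]"
    by (simp add: pCons.IH pcompose_pCons algebra_simps)
  finally show ?case .
qed

section \<open>Structure polynomials\<close>

text \<open>
  With \<open>d\<^sub>i f(x) = g\<^sub>i(x) f(x - i)\<close> and \<open>C f = c f\<close>, the assumption \<open>central\<close> is \<open>[C, d\<^sub>i] = 0\<close> and
  \<open>bracket\<close> is the Virasoro relation for \<open>[d\<^sub>i, d\<^sub>j]\<close>, both applied to 1 and evaluated at \<open>z\<close>.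
\<close>
locale virasoro_rank_one =
  fixes g :: "int \<Rightarrow> complex poly" and c :: "complex poly"
  assumes g_zero: "g 0 = [:0, 1:]"
    and central: "poly (g i) z * poly c (z - of_int i) = poly c z * poly (g i) z"
    and bracket: "poly (g i) z * poly (g j) (z - of_int i) - poly (g j) z * poly (g i) (z - of_int j)
      = of_int (j - i) * poly (g (i + j)) z
        + (if i = - j then (of_int i ^ 3 - of_int i) / 12 * poly c z else 0)"
begin

text \<open>
  The second hypothesis holds outright for \<open>i = 1\<close>, where the coefficient of \<open>c\<close> vanishes. That
  case is what shows \<open>c\<close> to be constant, after which the hypothesis holds for every \<open>i\<close>.
\<close>
lemma degree_opposite:
  assumes "i \<noteq> 0" and "\<And>z. (of_int i ^ 3 - of_int i) / 12 * poly c z = e"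
  shows "degree (g i) + degree (g (- i)) = 2" and "g i \<noteq> 0"
proof -
  define h where "h = g i * pcompose (g (- i)) [:- of_int i, 1:]"
  have "poly h (z + of_int i) - poly h z = 2 * of_int i * z + (- e)" for z
    using bracket[of i z "- i"] unfolding assms(2)
    by (simp add: h_def poly_pcompose g_zero algebra_simps)
  with degree_of_linear_difference[of "of_int i" h] assms(1)
  have deg: "degree h = 2" by simp
  then have "h \<noteq> 0" by auto
  then show "g i \<noteq> 0" by (auto simp: h_def)
  show "degree (g i) + degree (g (- i)) = 2"
    using deg \<open>h \<noteq> 0\<close> unfolding h_def
    by (subst (asm) degree_mult_eq) (auto simp: degree_pcompose)
qed

lemma central_constant: "poly c z = poly c 0"
proof -
  have "g 1 \<noteq> 0" by (rule degree_opposite(2)[of 1 0]) auto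
  have "g 1 * (pcompose c [:-1, 1:] - c) = 0"
  proof (rule poly_ext)
    show "poly (g 1 * (pcompose c [:-1, 1:] - c)) z = poly 0 z" for z
      using central[of 1 z] by (simp add: poly_pcompose algebra_simps)
  qed
  with \<open>g 1 \<noteq> 0\<close> have shift: "pcompose c [:-1, 1:] = c" by simp
  have "poly c (z + 1) = poly c z" for z
    using arg_cong[OF shift, of "\<lambda>p. poly p (z + 1)"] by (simp add: poly_pcompose)
  from periodic_poly_constant[OF one_neq_zero this] show ?thesis .
qed

lemma degrees:
  assumes "i \<noteq> 0"
  shows "degree (g i) + degree (g (- i)) = 2" and "g i \<noteq> 0"
  by (rule degree_opposite[OF assms arg_cong[OF central_constant]])+

text \<open>
  If \<open>g\<^sub>i\<close> were a constant \<open>r\<close>, the relation for \<open>[d\<^sub>i, d\<^bsub>mi\<^esub>]\<close> would express \<open>g\<^bsub>(m+1)i\<^esub>\<close> as a multiple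
  of the difference \<open>g\<^bsub>mi\<^esub>(x - i) - g\<^bsub>mi\<^esub>(x)\<close>, whose degree is smaller. Starting from
  \<open>deg g\<^bsub>2i\<^esub> \<le> 2\<close>, three steps reach \<open>g\<^bsub>5i\<^esub> = 0\<close>, although no \<open>g\<^sub>j\<close> with \<open>j \<noteq> 0\<close> vanishes.
\<close>
lemma degree_nonzero:
  assumes "i \<noteq> 0"
  shows "degree (g i) \<noteq> 0"
proof
  assume "degree (g i) = 0"
  then obtain r where r: "g i = [:r:]" by (metis degree_eq_zeroE)
  \<comment> \<open>\<open>m \<ge> 2\<close> keeps the indices \<open>i\<close> and \<open>m i\<close> from being opposite, so no central term appears.\<close>
  have step: "of_int ((m - 1) * i) * poly (g ((m + 1) * i)) z
      = r * (poly (g (m * i)) (z - of_int i) - poly (g (m * i)) z)" if "m \<ge> 2" for m z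
  proof -
    have "(m + 1) * i \<noteq> 0" using that assms by simp
    then have "i \<noteq> - (m * i)" by (simp add: algebra_simps)
    then show ?thesis using bracket[of i z "m * i"] by (simp add: r algebra_simps)
  qed
  have "degree (g (2 * i)) \<le> 2" using degrees(1)[of "2 * i"] assms by simp
  then obtain u v w where p2: "\<And>z. poly (g (2 * i)) z = u + v * z + w * z\<^sup>2"
    using poly_of_degree_le_2 by blast
  define k :: complex where "k = of_int i"
  have k: "k \<noteq> 0" using assms by (simp add: k_def)
  have rec: "of_int (m - 1) * k * poly (g ((m + 1) * i)) z
      = r * (poly (g (m * i)) (z - k) - poly (g (m * i)) z)" if "m \<ge> 2" for m z
    using step[OF that] by (simp add: k_def)
  have p3: "poly (g (3 * i)) z = r / k * (w * k\<^sup>2 - v * k - 2 * w * k * z)" for z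
  proof -
    have "k * poly (g (3 * i)) z = r * (poly (g (2 * i)) (z - k) - poly (g (2 * i)) z)"
      using rec[of 2 z] by simp
    then show ?thesis using k unfolding p2 by (simp add: field_simps power2_eq_square)
  qed
  have p4: "poly (g (4 * i)) z = r / k * (r / k) * (w * k\<^sup>2)" for z
  proof -
    have "2 * k * poly (g (4 * i)) z = r * (poly (g (3 * i)) (z - k) - poly (g (3 * i)) z)"
      using rec[of 3 z] by simp
    then show ?thesis using k unfolding p3 by (simp add: field_simps power2_eq_square)
  qed
  have "poly (g (5 * i)) z = 0" for z
    using rec[of 4 z] k by (simp add: p4)
  then have "g (5 * i) = 0" by (simp add: poly_ext)
  with degrees(2)[of "5 * i"] assms show False by simp
qed

definition lead :: "int \<Rightarrow> complex" where "lead i = coeff (g i) 1"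

definition zero_at :: "int \<Rightarrow> complex" where "zero_at i = - coeff (g i) 0 / coeff (g i) 1"

lemma degree_g: "degree (g i) = 1"
proof (cases "i = 0")
  case False
  then show ?thesis
    using degrees(1)[of i] degree_nonzero[of i] degree_nonzero[of "- i"] by simp
qed (simp add: g_zero)

lemma lead_nonzero: "lead i \<noteq> 0"
  using degree_g[of i] leading_coeff_0_iff[of "g i"] unfolding lead_def by auto

lemma g_linear: "g i = smult (lead i) [:- zero_at i, 1:]"
proof (rule poly_eqI)
  fix n
  show "coeff (g i) n = coeff (smult (lead i) [:- zero_at i, 1:]) n"
    using degree_g[of i] lead_nonzero[of i]
    by (cases "n \<le> 1") (auto simp: lead_def zero_at_def coeff_pCons coeff_eq_0 le_Suc_eq
        split: nat.split)
qed

lemma poly_g: "poly (g i) z = lead i * (z - zero_at i)"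
  by (subst g_linear) (simp add: algebra_simps)

lemma lead_zero_at_0: "lead 0 = 1" "zero_at 0 = 0"
  by (simp_all add: lead_def zero_at_def g_zero)

text \<open>
  For linear \<open>g\<^sub>i\<close> the quadratic terms of the two products in \<open>bracket\<close> cancel; these are the
  remaining coefficients, of \<open>z\<close> and of 1.
\<close>
lemma bracket_coeffs:
  "lead i * lead j * of_int (j - i) = of_int (j - i) * lead (i + j)"
  "lead i * lead j * (of_int i * zero_at i - of_int j * zero_at j)
     = - (of_int (j - i) * lead (i + j) * zero_at (i + j))
       + (if i = - j then (of_int i ^ 3 - of_int i) / 12 * poly c 0 else 0)"
proof -
  define e where "e = (if i = - j then (of_int i ^ 3 - of_int i) / 12 * poly c 0 else 0)"
  have eq: "(lead i * lead j * of_int (j - i)) * z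
        + lead i * lead j * (of_int i * zero_at i - of_int j * zero_at j)
      = (of_int (j - i) * lead (i + j)) * z
        + (- (of_int (j - i) * lead (i + j) * zero_at (i + j)) + e)" for z
  proof -
    have "(lead i * (z - zero_at i)) * (lead j * (z - of_int i - zero_at j))
        - (lead j * (z - zero_at j)) * (lead i * (z - of_int j - zero_at i))
        = of_int (j - i) * (lead (i + j) * (z - zero_at (i + j))) + e"
      using bracket[of i z j]
      unfolding central_constant[of z] e_def[symmetric]
        poly_g .
    then show ?thesis unfolding of_int_diff by algebra
  qed
  have affine: "p = p' \<and> q = q'" if "\<And>z. p * z + q = p' * z + q'" for p q p' q' :: complex
    using that[of 0] that[of 1] by simp
  show "lead i * lead j * of_int (j - i) = of_int (j - i) * lead (i + j)"
    "lead i * lead j * (of_int i * zero_at i - of_int j * zero_at j)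
     = - (of_int (j - i) * lead (i + j) * zero_at (i + j))
       + (if i = - j then (of_int i ^ 3 - of_int i) / 12 * poly c 0 else 0)"
    using affine[OF eq] unfolding e_def by blast+
qed

lemma lead_add: "i \<noteq> j \<Longrightarrow> lead (i + j) = lead i * lead j"
  using bracket_coeffs(1)[of i j] by simp

lemma zero_at_add:
  assumes "i \<noteq> j" "i \<noteq> - j"
  shows "of_int (j - i) * zero_at (i + j) = of_int j * zero_at j - of_int i * zero_at i"
proof -
  have "lead i * lead j *
      (of_int i * zero_at i - of_int j * zero_at j + of_int (j - i) * zero_at (i + j)) = 0"
    using bracket_coeffs(2)[of i j] assms by (simp add: lead_add algebra_simps)
  then have "of_int i * zero_at i - of_int j * zero_at j + of_int (j - i) * zero_at (i + j) = 0"
    using lead_nonzero[of i] lead_nonzero[of j] by (simp only: mult_eq_0_iff simp_thms)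
  then show ?thesis by (simp add: algebra_simps)
qed

lemma zero_at_opposite:
  assumes "i \<noteq> 0"
  shows "zero_at i + zero_at (- i) = (of_int i ^ 2 - 1) / 12 * poly c 0"
proof -
  have "lead i * lead (- i) = 1"
    using lead_add[of i "- i"] assms by (simp add: lead_zero_at_0)
  then have "of_int i * (zero_at i + zero_at (- i)) = of_int i * ((of_int i ^ 2 - 1) / 12 * poly c 0)"
    using bracket_coeffs(2)[of i "- i"]
    by (simp add: lead_zero_at_0 algebra_simps power2_eq_square power3_eq_cube diff_divide_distrib)
  then show ?thesis using assms by (metis mult_cancel_left of_int_eq_0_iff)
qed

text \<open>
  \<open>lead_add\<close> cannot be used with \<open>i = j\<close>, so the step from \<open>lead 1\<close> to \<open>lead 2\<close> goes through
  \<open>1 = 2 + (-1)\<close> instead.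
\<close>
lemma lead_powi: "lead i = lead 1 powi i"
proof -
  have inv: "lead 1 * lead (- 1) = 1"
    using lead_add[of 1 "- 1"] by (simp add: lead_zero_at_0)
  have suc: "lead (j + 1) = lead j * lead 1" for j
  proof (cases "j = 1")
    case True
    have "lead 1 = lead 2 * lead (- 1)" using lead_add[of 2 "- 1"] by simp
    then have "lead 1 * lead 1 = lead 2 * (lead 1 * lead (- 1))" by simp
    then show ?thesis using True inv by simp
  qed (simp add: lead_add)
  show ?thesis
  proof (induction i rule: int_induct[where k = 0])
    case base
    show ?case by (simp add: lead_zero_at_0)
  next
    case (step1 i)
    then show ?case by (simp add: suc power_int_add_1 lead_nonzero)
  next
    case (step2 i)
    have "lead (i - 1) * lead 1 = lead 1 powi (i - 1) * lead 1"
      using suc[of "i - 1"] step2 power_int_add_1[of "lead 1" "i - 1"] lead_nonzero by simp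
    then show ?case using lead_nonzero[of 1] by simp
  qed
qed

text \<open>
  Stepping up by \<open>[d\<^sub>1, d\<^sub>i]\<close> fails at \<open>i = 1\<close>. Instead \<open>[d\<^bsub>i+1\<^esub>, d\<^bsub>-1\<^esub>]\<close>, which relates the indices
  \<open>i\<close>, \<open>i + 1\<close> and \<open>-1\<close>, is solved for \<open>zero_at (i + 1)\<close>; its coefficient \<open>i + 1\<close> is nonzero for all
  \<open>i \<ge> 1\<close>. Negative indices are reached symmetrically with \<open>d\<^sub>1\<close>.
\<close>
lemma zero_at_multiple: "zero_at i = of_int i * zero_at 1"
proof -
  have minus1: "zero_at (- 1) = - zero_at 1"
    using zero_at_opposite[of 1] by (simp add: add_eq_0_iff)
  have pos: "zero_at i = of_int i * zero_at 1" if "i \<ge> 1" for i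
    using that
  proof (induction i rule: int_ge_induct)
    case (step i)
    have "of_int (i + 1) * zero_at (i + 1) = of_int (i + 1) * (of_int (i + 1) * zero_at 1)"
      using zero_at_add[of "i + 1" "- 1"] step minus1 by (simp add: algebra_simps)
    moreover have "i + 1 \<noteq> 0" using step(1) by simp
    ultimately show ?case by (metis mult_cancel_left of_int_eq_0_iff)
  qed simp
  have neg: "zero_at i = of_int i * zero_at 1" if "i \<le> - 1" for i
    using that
  proof (induction i rule: int_le_induct)
    case base
    show ?case using minus1 by simp
  next
    case (step i)
    have "of_int (i - 1) * zero_at (i - 1) = of_int (i - 1) * (of_int (i - 1) * zero_at 1)"
      using zero_at_add[of "i - 1" 1] step by (simp add: algebra_simps)
    moreover have "i - 1 \<noteq> 0" using step(1) by simp
    ultimately show ?case by (metis mult_cancel_left of_int_eq_0_iff)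
  qed
  show ?thesis
    using pos[of i] neg[of i] lead_zero_at_0(2) by (cases i "0 :: int" rule: linorder_cases) auto
qed

lemma central_zero: "c = 0"
proof -
  have "poly c 0 = 0"
    using zero_at_opposite[of 2] zero_at_multiple[of 2] zero_at_multiple[of "- 2"] by simp
  then have "poly c z = 0" for z using central_constant[of z] by simp
  then show ?thesis by (simp add: poly_ext)
qed

end

section \<open>Module structures on the polynomial ring\<close>

lemma poly_module_eq_omega:
  assumes "lie_module vir_scale vir_bracket smult act"
    and d0: "\<And>f. act (vir_d 0) f = [:0, 1:] * f"
  shows "\<exists>a l. l \<noteq> 0 \<and> act = omega_act l a"
proof -
  interpret lie_module vir_scale vir_bracket smult act by fact
  define g where "g i = act (vir_d i) 1" for i
  define c where "c = act vir_c 1"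
  have zero: "act 0 f = 0" for f using act_add_left[of 0 0 f] by simp
  have d: "act (vir_d i) f = g i * pcompose f [:- of_int i, 1:]" for i f
    unfolding g_def
  proof (rule shift_semilinear)
    fix p
    have "smult (of_int i) (act (vir_d i) p) = act (vir_bracket (vir_d 0) (vir_d i)) p"
      by (simp only: vir_bracket_basis) (simp add: act_scale_left zero del: vir_scale_single)
    also have "\<dots> = [:0, 1:] * act (vir_d i) p - act (vir_d i) ([:0, 1:] * p)"
      by (simp only: act_bracket d0)
    finally show "act (vir_d i) ([:0, 1:] * p) = [:- of_int i, 1:] * act (vir_d i) p"
      by (simp add: algebra_simps)
  qed (simp_all add: act_add_right act_scale_right)
  have C: "act vir_c f = c * f" for f
  proof -
    have "act vir_c f = act vir_c 1 * pcompose f [:- 0, 1:]"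
    proof (rule shift_semilinear)
      fix p
      have "act vir_c (act (vir_d 0) p) - act (vir_d 0) (act vir_c p) = 0"
        by (simp only: act_bracket[symmetric] vir_bracket_basis zero)
      then show "act vir_c ([:0, 1:] * p) = [:- 0, 1:] * act vir_c p"
        by (simp add: d0)
    qed (simp_all add: act_add_right act_scale_right)
    then show ?thesis by (simp add: c_def pcompose_idR)
  qed
  \<comment> \<open>On the vector 1 the module axioms are exactly the functional equations for \<open>g\<close> and \<open>c\<close>.\<close>
  interpret virasoro_rank_one g c
  proof
    show "g 0 = [:0, 1:]" by (simp add: g_def d0)
  next
    fix i z
    have "act (vir_d i) (act vir_c 1) = act vir_c (act (vir_d i) 1)"
      using act_bracket[of vir_c "vir_d i" 1] by (simp add: vir_bracket_basis zero)
    then show "poly (g i) z * poly c (z - of_int i) = poly c z * poly (g i) z"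
      using arg_cong[where f = "\<lambda>p. poly p z"] by (fastforce simp: d C poly_pcompose)
  next
    fix i j :: int and z
    have "act (vir_bracket (vir_d i) (vir_d j)) 1 = smult (of_int (j - i)) (g (i + j))
        + (if i = - j then smult ((of_int i ^ 3 - of_int i) / 12) c else 0)"
      by (simp only: vir_bracket_basis)
        (simp add: act_add_left act_scale_left g_def c_def zero del: vir_scale_single)
    moreover have "act (vir_bracket (vir_d i) (vir_d j)) 1
        = g i * pcompose (g j) [:- of_int i, 1:] - g j * pcompose (g i) [:- of_int j, 1:]"
      by (simp add: act_bracket d pcompose_1)
    ultimately have
      "poly (g i * pcompose (g j) [:- of_int i, 1:] - g j * pcompose (g i) [:- of_int j, 1:]) z
      = poly (smult (of_int (j - i)) (g (i + j))
        + (if i = - j then smult ((of_int i ^ 3 - of_int i) / 12) c else 0)) z"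
      by simp
    then show "poly (g i) z * poly (g j) (z - of_int i) - poly (g j) z * poly (g i) (z - of_int j)
      = of_int (j - i) * poly (g (i + j)) z
        + (if i = - j then (of_int i ^ 3 - of_int i) / 12 * poly c z else 0)"
      by (simp add: poly_pcompose split: if_splits)
  qed
  \<comment> \<open>In \<open>\<Omega>(\<lambda>, a)\<close> the zero of \<open>d\<^sub>i 1\<close> is \<open>i (a + 1)\<close>, hence \<open>a + 1 = zero_at 1\<close>.\<close>
  have "act x f = omega_act (lead 1) (zero_at 1 - 1) x f" for x f
  proof (induction x rule: virasoro_induct)
    case (single u r)
    have "act (Poly_Mapping.single u r) f = smult r (act (Poly_Mapping.single u 1) f)"
      by (simp flip: act_scale_left)
    also have "act (Poly_Mapping.single u 1) f = omega_basis_act (lead 1) (zero_at 1 - 1) u f"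
    proof (cases u)
      case (VirD i)
      have "g i = smult (lead 1 powi i) [:- (of_int i * (zero_at 1 - 1 + 1)), 1:]"
        by (subst g_linear, subst lead_powi, subst zero_at_multiple) simp
      then show ?thesis using VirD d by (simp add: smult_diff_right)
    qed (simp add: C central_zero)
    finally show ?case by (simp add: omega_act_single)
  qed (simp add: act_add_left omega_act_add_left)
  then show ?thesis using lead_nonzero[of 1] by blast
qed

section \<open>Transport along a free generator\<close>

lemma (in module) free_of_rank_1_generator:
  assumes "free_of_rank 1"
  obtains v where "bij (\<lambda>r. scale r v)"
proof -
  from assms obtain v where v: "independent {v}" "span {v} = UNIV"
    unfolding free_of_rank_def by (metis card_1_singletonE)
  have "inj (\<lambda>r. scale r v)"
  proof (rule injI)
    fix r s assume "scale r v = scale s v"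
    then have "(\<Sum>w\<in>{v}. scale (r - s) w) = 0" by (simp add: scale_left_diff_distrib)
    then have "r - s = 0"
      using v(1) independentD[of "{v}" "{v}" "\<lambda>_. r - s" v] by blast
    then show "r = s" by simp
  qed
  moreover have "surj (\<lambda>r. scale r v)"
    using v(2) by (simp add: span_singleton)
  ultimately show ?thesis using that by (simp add: bij_def)
qed

lemma lie_module_transport:
  assumes "lie_module scaleL br scaleM act"
    and "vector_space scaleN" and "bij \<psi>"
    and add: "\<And>p q. \<psi> (p + q) = \<psi> p + \<psi> q"
    and scale: "\<And>r p. \<psi> (scaleN r p) = scaleM r (\<psi> p)"
  shows "lie_module scaleL br scaleN (\<lambda>x p. inv \<psi> (act x (\<psi> p)))"
proof -
  interpret lie_module scaleL br scaleM act by fact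
  interpret N: vector_space scaleN by fact
  have \<psi>_inv: "\<psi> (inv \<psi> m) = m" for m
    using \<open>bij \<psi>\<close> by (simp add: bij_is_surj surj_f_inv_f)
  have eqI: "p = q" if "\<psi> p = \<psi> q" for p q
    using that \<open>bij \<psi>\<close> by (meson bij_is_inj injD)
  have diff: "\<psi> (p - q) = \<psi> p - \<psi> q" for p q
    using add[of "p - q" q] by (simp add: algebra_simps)
  show ?thesis
    by unfold_locales
      (rule eqI, simp add: \<psi>_inv add scale diff act_add_left act_add_right act_scale_left
        act_scale_right act_bracket)+
qed

theorem theorem3:
  fixes scaleM :: "complex \<Rightarrow> 'm::ab_group_add \<Rightarrow> 'm"
    and act :: "virasoro \<Rightarrow> 'm \<Rightarrow> 'm"
  assumes "lie_module vir_scale vir_bracket scaleM act"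
    and "module.free_of_rank (poly_act scaleM (act (vir_d 0))) 1"
  shows "\<exists>a l. l \<noteq> 0 \<and> lie_module_isomorphic scaleM act smult (omega_act l a)"
proof -
  interpret lie_module vir_scale vir_bracket scaleM act by fact
  let ?d = "act (vir_d 0)"
  interpret P: module "poly_act scaleM ?d" by (rule module_restrict)
  obtain v where bij: "bij (\<lambda>p. poly_act scaleM ?d p v)"
    using P.free_of_rank_1_generator assms(2) by blast
  define \<psi> where "\<psi> p = poly_act scaleM ?d p v" for p
  have bij: "bij \<psi>" using bij by (simp add: \<psi>_def[abs_def])
  have add: "\<psi> (p + q) = \<psi> p + \<psi> q" for p q
    by (simp add: \<psi>_def P.scale_left_distrib)
  have const: "poly_act scaleM ?d [:r:] m = scaleM r m" for r m
    by (simp add: poly_act_def)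
  have scale: "\<psi> (smult r p) = scaleM r (\<psi> p)" for r p
  proof -
    have "smult r p = [:r:] * p" by simp
    then show ?thesis by (simp only: \<psi>_def P.scale_scale[symmetric] const)
  qed
  have X: "poly_act scaleM ?d [:0, 1:] m = ?d m" for m
    by (simp add: poly_act_def)
  have times_X: "\<psi> ([:0, 1:] * p) = ?d (\<psi> p)" for p
    using P.scale_scale[of "[:0, 1:]" p v] X by (simp only: \<psi>_def)
  have inv_\<psi>: "inv \<psi> (\<psi> p) = p" for p using bij by (simp add: bij_is_inj)
  have \<psi>_inv: "\<psi> (inv \<psi> m) = m" for m using bij by (simp add: bij_is_surj surj_f_inv_f)
  have "lie_module vir_scale vir_bracket smult (\<lambda>x p. inv \<psi> (act x (\<psi> p)))"
    using assms(1) vector_space_poly bij add scale by (rule lie_module_transport)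
  moreover have "inv \<psi> (?d (\<psi> p)) = [:0, 1:] * p" for p
    by (metis times_X inv_\<psi>)
  ultimately obtain a l where "l \<noteq> 0" and l: "(\<lambda>x p. inv \<psi> (act x (\<psi> p))) = omega_act l a"
    using poly_module_eq_omega by metis
  have "Vector_Spaces.linear scaleM smult (inv \<psi>)"
    unfolding Vector_Spaces.linear_iff
    using M.vector_space_axioms vector_space_poly
    by (metis add scale inv_\<psi> \<psi>_inv)
  moreover have "inv \<psi> (act x m) = omega_act l a x (inv \<psi> m)" for x m
    by (simp add: \<psi>_inv flip: l)
  ultimately have "lie_module_isomorphic scaleM act smult (omega_act l a)"
    using bij_imp_bij_inv[OF bij] unfolding lie_module_isomorphic_def by blast
  with \<open>l \<noteq> 0\<close> show ?thesis by blast
qed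

end
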